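(* Let $N$ be a timelike ruled surface of type $N_-$ in $\mathbb{R}_1^3$ with timelike striction curve $\vec c$, and let $N^\alpha$ be an $\alpha$-transversal surface of $N$ whose striction curve $\vec c_\alpha$ coincides with $\vec c$. Then $\vec c$ is an asymptotic line on $N$ if and only if $\alpha$ is constant.
   Context: $\mathbb{R}_1^3$ is Minkowski 3-space with metric $\langle\cdot,\cdot\rangle=-dx_1^2+dx_2^2+dx_3^2$. A nonzero vector $\vec v$ is timelike if $\langle\vec v,\vec v\rangle<0$, null if $\langle\vec v,\vec v\rangle=0$, spacelike if $\langle\vec v,\vec v\rangle>0$. Setting. All functions are smooth on an open interval $I$. A timelike ruled surface of type $N_-$ with timelike striction curve is $\vec r(s,v)=\vec c(s)+v\vec q(s)$, with ruling direction $\vec q$ unit timelike, where $\vec c$ is its striction curve, a timelike curve parametrized by arc length $s$. It has a Frenet frame $\{\vec q,\vec h,\vec a\}$ of mutually orthogonal vectors, $\langle\vec q,\vec q\rangle=-1$, $\langle\vec h,\vec h\rangle=\langle\vec a,\vec a\rangle=1$ ($\vec h$ is the central normal, i.e. the surface normal along $\vec c$; $\vec a$ the central tangent), with $\vec q\,'=k_1\vec h$, $\vec h'=k_1\vec q+k_2\vec a$, $\vec a'=-k_2\vec h$ (prime is $d/ds$) for functions $k_1,k_2$. Standing assumption: the derivatives of the frame vectors are non-null and $N$ is non-cylindrical; in particular $k_1\neq0$ and $k_1^2\neq k_2^2$ everywhere. The unit tangent of $\vec c$ is $\vec c\,'=\vec t=\cosh\theta\,\vec q+\sinh\theta\,\vec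 a$ for a real function $\theta$ (the hyperbolic angle between $\vec t$ and $\vec q$). $\alpha$-transversal surface. For a function $\alpha:I\to\mathbb{R}$, $N^\alpha$ is the ruled surface $\vec r_\alpha(s,v)=\vec c(s)+v\vec q_\alpha(s)$ with $\vec q_\alpha=\mu\vec q+\eta\vec h$, where either $(\mu,\eta)=(\cosh\alpha,\sinh\alpha)$ on all of $I$ ($\vec q_\alpha$ timelike) or $(\mu,\eta)=(\sinh\alpha,\cosh\alpha)$ on all of $I$ ($\vec q_\alpha$ spacelike); it is assumed that $\mu\ne0$ and $\eta\neq0$ everywhere and that $\langle\vec q_\alpha',\vec q_\alpha'\rangle\neq0$ everywhere. Its striction curve is $\vec c_\alpha=\vec c+v_\alpha\vec q_\alpha$ with $v_\alpha=-\langle\vec c\,',\vec q_\alpha'\rangle/\langle\vec q_\alpha',\vec q_\alpha'\rangle$; it coincides with $\vec c$ if $v_\alpha=0$ on $I$. The curve $\vec c$ is an asymptotic line on $N$ if $\langle\vec h,\vec c\,''\rangle=0$ on $I$. *)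

theory Defs
  imports "HOL-Analysis.Analysis"
begin

text \<open>Minkowski 3-space: \<open>real^3\<close> with the metric of signature \<open>(-,+,+)\<close>.\<close>

definition lorentz :: "real^3 \<Rightarrow> real^3 \<Rightarrow> real" where
  "lorentz x y = - (x $ 1 * y $ 1) + x $ 2 * y $ 2 + x $ 3 * y $ 3"

lemma lorentz_commute: "lorentz x y = lorentz y x"
  by (simp add: lorentz_def mult.commute)

lemma lorentz_linear_combination:
  "lorentz w (x *\<^sub>R u + y *\<^sub>R v) = x * lorentz w u + y * lorentz w v"
  by (simp add: lorentz_def algebra_simps)

definition timelike :: "real^3 \<Rightarrow> bool" where
  "timelike v \<longleftrightarrow> v \<noteq> 0 \<and> lorentz v v < 0"

text \<open>The causal classification concerns nonzero vectors only, so \<open>0\<close> is not null.\<close>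

definition null_vector :: "real^3 \<Rightarrow> bool" where
  "null_vector v \<longleftrightarrow> v \<noteq> 0 \<and> lorentz v v = 0"

definition vderiv :: "(real \<Rightarrow> 'a::real_normed_vector) \<Rightarrow> real \<Rightarrow> 'a" where
  "vderiv f = (\<lambda>s. vector_derivative f (at s))"

text \<open>Smoothness is only ever used on open sets, where the two-sided derivatives at points
  of the set depend on the values of the function on the set only.\<close>

definition smooth_on :: "(real \<Rightarrow> 'a::real_normed_vector) \<Rightarrow> real set \<Rightarrow> bool" where
  "smooth_on f S \<longleftrightarrow> (\<forall>n. \<forall>s\<in>S. (vderiv ^^ n) f differentiable (at s))"

definition ruled_surface ::
    "(real \<Rightarrow> real^3) \<Rightarrow> (real \<Rightarrow> real^3) \<Rightarrow> real \<Rightarrow> real \<Rightarrow> real^3" where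
  "ruled_surface c q s v = c s + v *\<^sub>R q s"

definition striction_param :: "(real \<Rightarrow> real^3) \<Rightarrow> (real \<Rightarrow> real^3) \<Rightarrow> real \<Rightarrow> real" where
  "striction_param c q s =
     - (lorentz (vderiv c s) (vderiv q s) / lorentz (vderiv q s) (vderiv q s))"

definition striction_curve :: "(real \<Rightarrow> real^3) \<Rightarrow> (real \<Rightarrow> real^3) \<Rightarrow> real \<Rightarrow> real^3" where
  "striction_curve c q s = ruled_surface c q s (striction_param c q s)"

text \<open>
  The timelike ruled surface of type \<open>N\<^sub>-\<close> parametrized by \<open>ruled_surface c q\<close> over \<open>I\<close>, given
  by its timelike striction curve \<open>c\<close> (arc length parameter), its Frenet frame \<open>q, h, a\<close>, the
  curvatures \<open>k1, k2\<close> and the hyperbolic angle \<open>\<theta>\<close>. That the surface itself is timelike is no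
  extra condition: every tangent plane at a regular point contains the timelike vector \<open>q s\<close>.
\<close>

locale timelike_ruled_surface_Nminus =
  fixes I :: "real set"
    and c q h a :: "real \<Rightarrow> real^3"
    and k1 k2 \<theta> :: "real \<Rightarrow> real"
  assumes interval: "open I" "is_interval I" "I \<noteq> {}"
    and smooth: "smooth_on c I" "smooth_on q I" "smooth_on h I"
      "smooth_on a I" "smooth_on k1 I" "smooth_on k2 I" "smooth_on \<theta> I"
    and frame_norms: "\<And>s. s \<in> I \<Longrightarrow> lorentz (q s) (q s) = -1"
      "\<And>s. s \<in> I \<Longrightarrow> lorentz (h s) (h s) = 1"
      "\<And>s. s \<in> I \<Longrightarrow> lorentz (a s) (a s) = 1"
    and frame_orthogonal: "\<And>s. s \<in> I \<Longrightarrow> lorentz (q s) (h s) = 0"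
      "\<And>s. s \<in> I \<Longrightarrow> lorentz (q s) (a s) = 0"
      "\<And>s. s \<in> I \<Longrightarrow> lorentz (h s) (a s) = 0"
    and frenet: "\<And>s. s \<in> I \<Longrightarrow> vderiv q s = k1 s *\<^sub>R h s"
      "\<And>s. s \<in> I \<Longrightarrow> vderiv h s = k1 s *\<^sub>R q s + k2 s *\<^sub>R a s"
      "\<And>s. s \<in> I \<Longrightarrow> vderiv a s = - (k2 s *\<^sub>R h s)"
    and non_null: "\<And>s. s \<in> I \<Longrightarrow> \<not> null_vector (vderiv q s)"
      "\<And>s. s \<in> I \<Longrightarrow> \<not> null_vector (vderiv h s)"
      "\<And>s. s \<in> I \<Longrightarrow> \<not> null_vector (vderiv a s)"
    and non_cylindrical: "\<And>s. s \<in> I \<Longrightarrow> vderiv q s \<noteq> 0"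
    and timelike_arc_length: "\<And>s. s \<in> I \<Longrightarrow> timelike (vderiv c s)"
      "\<And>s. s \<in> I \<Longrightarrow> lorentz (vderiv c s) (vderiv c s) = -1"
    and striction: "\<And>s. s \<in> I \<Longrightarrow> striction_curve c q s = c s"
    and tangent: "\<And>s. s \<in> I \<Longrightarrow> vderiv c s = cosh (\<theta> s) *\<^sub>R q s + sinh (\<theta> s) *\<^sub>R a s"
begin

lemma k1_nonzero: "s \<in> I \<Longrightarrow> k1 s \<noteq> 0"
  using frenet(1) non_cylindrical by fastforce

lemma k1_k2:
  assumes s: "s \<in> I"
  shows "(k1 s)\<^sup>2 \<noteq> (k2 s)\<^sup>2"
proof -
  note orthonormal = frame_norms[OF s] frame_orthogonal[OF s]
  have q: "lorentz (q s) (vderiv h s) = - k1 s" and a: "lorentz (a s) (vderiv h s) = k2 s"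
    using orthonormal lorentz_commute[of "a s" "q s"]
    by (simp_all add: frenet(2)[OF s] lorentz_linear_combination)
  have "lorentz (vderiv h s) (vderiv h s)
      = k1 s * lorentz (vderiv h s) (q s) + k2 s * lorentz (vderiv h s) (a s)"
    using lorentz_linear_combination[of "vderiv h s" "k1 s" "q s" "k2 s" "a s"]
    by (simp only: frenet(2)[OF s, symmetric])
  then have norm: "lorentz (vderiv h s) (vderiv h s) = (k2 s)\<^sup>2 - (k1 s)\<^sup>2"
    using q a lorentz_commute[of "q s" "vderiv h s"] lorentz_commute[of "a s" "vderiv h s"]
    by (simp add: power2_eq_square)
  have "vderiv h s \<noteq> 0"
    using q k1_nonzero[OF s] by (auto simp: lorentz_def)
  then show ?thesis
    using norm non_null(2)[OF s] by (auto simp: null_vector_def)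
qed

text \<open>\<open>h\<close> is the surface normal along \<open>c\<close>, i.e. along \<open>v = 0\<close>.\<close>

lemma h_normal_along_c:
  assumes s: "s \<in> I"
  shows "lorentz (h s) (vderiv (\<lambda>t. ruled_surface c q t 0) s) = 0"
    and "lorentz (h s) (vderiv (\<lambda>v. ruled_surface c q s v) 0) = 0"
proof -
  have "(\<lambda>t. ruled_surface c q t 0) = c"
    by (simp add: ruled_surface_def)
  then show "lorentz (h s) (vderiv (\<lambda>t. ruled_surface c q t 0) s) = 0"
    using frame_orthogonal[OF s] lorentz_commute[of "h s" "q s"]
    by (simp add: tangent[OF s] lorentz_linear_combination)
  have "((\<lambda>v. c s + v *\<^sub>R q s) has_vector_derivative q s) (at 0)"
    by (auto intro!: derivative_eq_intros)
  then have "vderiv (\<lambda>v. ruled_surface c q s v) 0 = q s"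
    by (simp add: vderiv_def ruled_surface_def vector_derivative_at)
  then show "lorentz (h s) (vderiv (\<lambda>v. ruled_surface c q s v) 0) = 0"
    using frame_orthogonal(1)[OF s] by (simp add: lorentz_commute)
qed

end

definition transversal_ruling ::
    "(real \<Rightarrow> real) \<Rightarrow> (real \<Rightarrow> real) \<Rightarrow> (real \<Rightarrow> real^3) \<Rightarrow> (real \<Rightarrow> real^3) \<Rightarrow> real \<Rightarrow> real^3" where
  "transversal_ruling \<mu> \<eta> q h = (\<lambda>s. \<mu> s *\<^sub>R q s + \<eta> s *\<^sub>R h s)"

text \<open>
  The surface \<open>ruled_surface c (transversal_ruling \<mu> \<eta> q h)\<close> over \<open>I\<close> is an \<open>\<alpha>\<close>-transversal
  surface of \<open>ruled_surface c q\<close>: its ruling is timelike on all of \<open>I\<close> (first disjunct) or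
  spacelike on all of \<open>I\<close> (second disjunct).
\<close>

definition alpha_transversal ::
    "real set \<Rightarrow> (real \<Rightarrow> real^3) \<Rightarrow> (real \<Rightarrow> real^3) \<Rightarrow> (real \<Rightarrow> real)
      \<Rightarrow> (real \<Rightarrow> real) \<Rightarrow> (real \<Rightarrow> real) \<Rightarrow> bool" where
  "alpha_transversal I q h \<alpha> \<mu> \<eta> \<longleftrightarrow>
     smooth_on \<alpha> I \<and>
     ((\<forall>s\<in>I. \<mu> s = cosh (\<alpha> s) \<and> \<eta> s = sinh (\<alpha> s)) \<or>
      (\<forall>s\<in>I. \<mu> s = sinh (\<alpha> s) \<and> \<eta> s = cosh (\<alpha> s))) \<and>
     (\<forall>s\<in>I. \<mu> s \<noteq> 0 \<and> \<eta> s \<noteq> 0) \<and>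
     (\<forall>s\<in>I. lorentz (vderiv (transversal_ruling \<mu> \<eta> q h) s)
                     (vderiv (transversal_ruling \<mu> \<eta> q h) s) \<noteq> 0)"

text \<open>\<open>h\<close> is the surface normal along \<open>c\<close>.\<close>

definition asymptotic_line :: "real set \<Rightarrow> (real \<Rightarrow> real^3) \<Rightarrow> (real \<Rightarrow> real^3) \<Rightarrow> bool" where
  "asymptotic_line I h c \<longleftrightarrow> (\<forall>s\<in>I. lorentz (h s) (vderiv (vderiv c) s) = 0)"

end

theory Submission
  imports Defs
begin

text \<open>
  Both families satisfy \<open>\<mu>' = \<alpha>' \<eta>\<close>, so the \<open>q\<close>-coefficient of \<open>q\<^sub>\<alpha>'\<close> is \<open>\<eta> (\<alpha>' + k\<^sub>1)\<close> and its
  \<open>a\<close>-coefficient is \<open>\<eta> k\<^sub>2\<close>. As \<open>q\<^sub>\<alpha>\<close> and \<open>\<eta>\<close> do not vanish, the striction curve of \<open>N\<^sup>\<alpha>\<close> is \<open>c\<close>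
  iff \<open>\<alpha>' cosh \<theta> = - (k\<^sub>1 cosh \<theta> - k\<^sub>2 sinh \<theta>)\<close>. The bracket is \<open>\<langle>h, c''\<rangle>\<close>, so \<open>c\<close> is an asymptotic
  line iff \<open>\<alpha>' = 0\<close>.
\<close>

lemma lorentz_add_left: "lorentz (x + y) z = lorentz x z + lorentz y z"
  and lorentz_add_right: "lorentz z (x + y) = lorentz z x + lorentz z y"
  and lorentz_scaleR_left: "lorentz (r *\<^sub>R x) z = r * lorentz x z"
  and lorentz_scaleR_right: "lorentz z (r *\<^sub>R x) = r * lorentz z x"
  and lorentz_diff_left: "lorentz (x - y) z = lorentz x z - lorentz y z"
  and lorentz_diff_right: "lorentz z (x - y) = lorentz z x - lorentz z y"
  by (simp_all add: lorentz_def algebra_simps)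

lemmas lorentz_bilinear = lorentz_add_left lorentz_add_right lorentz_scaleR_left
  lorentz_scaleR_right lorentz_diff_left lorentz_diff_right

lemma smooth_on_has_vector_derivative:
  assumes "smooth_on f S" "s \<in> S"
  shows "(f has_vector_derivative vderiv f s) (at s)"
proof -
  have "(vderiv ^^ 0) f differentiable at s"
    using assms unfolding smooth_on_def by blast
  then show ?thesis
    by (simp add: vderiv_def vector_derivative_works)
qed

lemma smooth_on_has_real_derivative:
  fixes f :: "real \<Rightarrow> real"
  assumes "smooth_on f S" "s \<in> S"
  shows "(f has_real_derivative vderiv f s) (at s)"
  using smooth_on_has_vector_derivative[OF assms]
  by (simp add: has_real_derivative_iff_has_vector_derivative)

text \<open>Openness of \<open>I\<close> makes the two-sided derivative depend only on values on
  \<open>I\<close>, which settles one direction. For the converse, an interval is convex, and a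
  vanishing derivative on a convex set forces constancy.\<close>

lemma constant_on_iff_vderiv_zero:
  fixes f :: "real \<Rightarrow> real"
  assumes "open I" "is_interval I" "smooth_on f I"
  shows "f constant_on I \<longleftrightarrow> (\<forall>s\<in>I. vderiv f s = 0)"
proof
  assume "f constant_on I"
  then obtain y where y: "\<And>x. x \<in> I \<Longrightarrow> f x = y"
    unfolding constant_on_def by blast
  show "\<forall>s\<in>I. vderiv f s = 0"
  proof
    fix s assume s: "s \<in> I"
    have "(f has_vector_derivative 0) (at s)"
      by (rule has_vector_derivative_transform_within_open[OF _ \<open>open I\<close> s])
        (auto simp: y intro: has_vector_derivative_const)
    then show "vderiv f s = 0"
      by (simp add: vderiv_def vector_derivative_at)
  qed
next
  assume zero: "\<forall>s\<in>I. vderiv f s = 0"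
  have "\<exists>y. \<forall>x\<in>I. f x = y"
  proof (rule has_field_derivative_zero_constant[THEN exE])
    show "convex I"
      using assms(2) by (rule is_interval_convex)
    fix s assume s: "s \<in> I"
    show "(f has_real_derivative 0) (at s within I)"
      using smooth_on_has_real_derivative[OF assms(3) s] zero s
      by (auto intro: has_field_derivative_at_within)
  qed blast
  then show "f constant_on I"
    by (simp add: constant_on_def)
qed

context timelike_ruled_surface_Nminus
begin

lemma frame_products:
  assumes "s \<in> I"
  shows "lorentz (q s) (q s) = -1" "lorentz (h s) (h s) = 1" "lorentz (a s) (a s) = 1"
    and "lorentz (q s) (h s) = 0" "lorentz (q s) (a s) = 0" "lorentz (h s) (a s) = 0"
    and "lorentz (h s) (q s) = 0" "lorentz (a s) (q s) = 0" "lorentz (a s) (h s) = 0"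
  using frame_norms[OF assms] frame_orthogonal[OF assms]
  by (simp_all add: lorentz_commute)

lemma frame_has_vector_derivative:
  assumes "s \<in> I"
  shows "(q has_vector_derivative k1 s *\<^sub>R h s) (at s)"
    and "(h has_vector_derivative k1 s *\<^sub>R q s + k2 s *\<^sub>R a s) (at s)"
    and "(a has_vector_derivative - (k2 s *\<^sub>R h s)) (at s)"
  using smooth_on_has_vector_derivative[OF smooth(2) assms]
    smooth_on_has_vector_derivative[OF smooth(3) assms]
    smooth_on_has_vector_derivative[OF smooth(4) assms]
  by (simp_all add: frenet[OF assms])

text \<open>Differentiating the tangent, the terms with the derivative of \<theta> lie along
  \<open>q\<close> and \<open>a\<close>, orthogonally to \<open>h\<close>. Only the Frenet
  derivatives of \<open>q\<close> and \<open>a\<close>, both multiples of \<open>h\<close>,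
  contribute.\<close>

lemma lorentz_h_acceleration:
  assumes s: "s \<in> I"
  shows "lorentz (h s) (vderiv (vderiv c) s) = k1 s * cosh (\<theta> s) - k2 s * sinh (\<theta> s)"
proof -
  note \<theta>' = smooth_on_has_real_derivative[OF smooth(7) s]
  let ?D = "cosh (\<theta> s) *\<^sub>R (k1 s *\<^sub>R h s) + (sinh (\<theta> s) * vderiv \<theta> s) *\<^sub>R q s
    + (sinh (\<theta> s) *\<^sub>R (- (k2 s *\<^sub>R h s)) + (cosh (\<theta> s) * vderiv \<theta> s) *\<^sub>R a s)"
  have "((\<lambda>t. cosh (\<theta> t) *\<^sub>R q t + sinh (\<theta> t) *\<^sub>R a t) has_vector_derivative ?D) (at s)"
    by (intro has_vector_derivative_add has_vector_derivative_scaleR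
        frame_has_vector_derivative[OF s])
      (auto intro!: derivative_eq_intros \<theta>')
  \<comment> \<open>The formula for the tangent is given on \<open>I\<close> only, but
    \<open>I\<close> is a neighbourhood of \<open>s\<close>.\<close>
  then have "(vderiv c has_vector_derivative ?D) (at s)"
    by (rule has_vector_derivative_transform_within_open[OF _ interval(1) s])
      (simp add: tangent)
  then have "vderiv (vderiv c) s = ?D"
    by (simp add: vderiv_def vector_derivative_at)
  then show ?thesis
    by (simp add: lorentz_bilinear frame_products[OF s])
qed

text \<open>The tangent has no \<open>h\<close>-component, so neither \<open>\<eta>'\<close> nor the
  term from the derivative of \<open>q\<close> survives. The \<open>q\<close>-components enter with
  a minus sign because \<open>q\<close> is timelike.\<close>

lemma lorentz_tangent_transversal_ruling:
  assumes s: "s \<in> I"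
    and \<mu>: "(\<mu> has_real_derivative \<mu>') (at s)" and \<eta>: "(\<eta> has_real_derivative \<eta>') (at s)"
  shows "lorentz (vderiv c s) (vderiv (transversal_ruling \<mu> \<eta> q h) s)
    = \<eta> s * k2 s * sinh (\<theta> s) - (\<mu>' + \<eta> s * k1 s) * cosh (\<theta> s)"
proof -
  let ?D = "\<mu> s *\<^sub>R (k1 s *\<^sub>R h s) + \<mu>' *\<^sub>R q s
    + (\<eta> s *\<^sub>R (k1 s *\<^sub>R q s + k2 s *\<^sub>R a s) + \<eta>' *\<^sub>R h s)"
  have "(transversal_ruling \<mu> \<eta> q h has_vector_derivative ?D) (at s)"
    unfolding transversal_ruling_def
    by (intro has_vector_derivative_add has_vector_derivative_scaleR
        frame_has_vector_derivative[OF s] \<mu> \<eta>)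
  then have "vderiv (transversal_ruling \<mu> \<eta> q h) s = ?D"
    by (simp add: vderiv_def vector_derivative_at)
  then show ?thesis
    by (simp add: lorentz_bilinear frame_products[OF s] tangent[OF s] algebra_simps)
qed

text \<open>Pairing with \<open>h\<close> isolates the coefficient \<eta>.\<close>

lemma transversal_ruling_nonzero:
  assumes s: "s \<in> I" and "\<eta> s \<noteq> 0"
  shows "transversal_ruling \<mu> \<eta> q h s \<noteq> 0"
proof
  assume "transversal_ruling \<mu> \<eta> q h s = 0"
  then have "lorentz (h s) (\<mu> s *\<^sub>R q s + \<eta> s *\<^sub>R h s) = 0"
    by (simp add: transversal_ruling_def lorentz_def)
  then show False
    using assms(2) by (simp add: lorentz_bilinear frame_products[OF s])
qed

lemma alpha_transversal_has_derivatives: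
  assumes \<alpha>: "alpha_transversal I q h \<alpha> \<mu> \<eta>" and s: "s \<in> I"
  shows "(\<mu> has_real_derivative vderiv \<alpha> s * \<eta> s) (at s)"
    and "(\<eta> has_real_derivative vderiv \<alpha> s * \<mu> s) (at s)"
proof -
  have smooth_\<alpha>: "smooth_on \<alpha> I"
    using \<alpha> by (simp add: alpha_transversal_def)
  note \<alpha>' = smooth_on_has_real_derivative[OF smooth_\<alpha> s]
  have ch: "((\<lambda>t. cosh (\<alpha> t)) has_real_derivative vderiv \<alpha> s * sinh (\<alpha> s)) (at s)"
    and sh: "((\<lambda>t. sinh (\<alpha> t)) has_real_derivative vderiv \<alpha> s * cosh (\<alpha> s)) (at s)"
    by (auto intro!: derivative_eq_intros \<alpha>')
  \<comment> \<open>The hyperbolic expressions for \<mu> and \<eta> are also known on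
    \<open>I\<close> only.\<close>
  note transform = has_field_derivative_transform_within_open[OF _ interval(1) s]
  consider "\<forall>s\<in>I. \<mu> s = cosh (\<alpha> s) \<and> \<eta> s = sinh (\<alpha> s)"
    | "\<forall>s\<in>I. \<mu> s = sinh (\<alpha> s) \<and> \<eta> s = cosh (\<alpha> s)"
    using \<alpha> unfolding alpha_transversal_def by blast
  then have "(\<mu> has_real_derivative vderiv \<alpha> s * \<eta> s) (at s) \<and>
      (\<eta> has_real_derivative vderiv \<alpha> s * \<mu> s) (at s)"
  proof cases
    case 1
    then show ?thesis
      using transform[OF ch, of \<mu>] transform[OF sh, of \<eta>] s by simp
  next
    case 2
    then show ?thesis
      using transform[OF sh, of \<mu>] transform[OF ch, of \<eta>] s by simp
  qed
  then show "(\<mu> has_real_derivative vderiv \<alpha> s * \<eta> s) (at s)"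
    and "(\<eta> has_real_derivative vderiv \<alpha> s * \<mu> s) (at s)"
    by simp_all
qed

text \<open>The common striction curve makes the tangent orthogonal to the derivative of the new
  ruling. Rewritten with the normal acceleration of \<open>c\<close>, this ties the derivative of
  \<alpha> to the asymptotic condition at each point.\<close>

lemma striction_coincides_imp:
  assumes \<alpha>: "alpha_transversal I q h \<alpha> \<mu> \<eta>" and s: "s \<in> I"
    and coincides: "striction_curve c (transversal_ruling \<mu> \<eta> q h) s = c s"
  shows "vderiv \<alpha> s * cosh (\<theta> s) = - lorentz (h s) (vderiv (vderiv c) s)"
proof -
  have \<eta>: "\<eta> s \<noteq> 0"
    and nonnull: "lorentz (vderiv (transversal_ruling \<mu> \<eta> q h) s)
      (vderiv (transversal_ruling \<mu> \<eta> q h) s) \<noteq> 0"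
    using \<alpha> s by (auto simp: alpha_transversal_def)
  \<comment> \<open>The displacement from \<open>c\<close> is this parameter times a nonzero
    ruling.\<close>
  have "striction_param c (transversal_ruling \<mu> \<eta> q h) s = 0"
    using coincides transversal_ruling_nonzero[OF s, of \<eta> \<mu>] \<eta>
    by (simp add: striction_curve_def ruled_surface_def)
  \<comment> \<open>A zero denominator would make the quotient 0 by convention, so the numerator
    vanishes only thanks to \<open>nonnull\<close>.\<close>
  then have "lorentz (vderiv c s) (vderiv (transversal_ruling \<mu> \<eta> q h) s) = 0"
    using nonnull by (simp add: striction_param_def)
  \<comment> \<open>The factor \<eta> splits off because the derivative of \<mu> is itself a
    multiple of \<eta>.\<close>
  then have "\<eta> s * (k2 s * sinh (\<theta> s) - (vderiv \<alpha> s + k1 s) * cosh (\<theta> s)) = 0"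
    using lorentz_tangent_transversal_ruling[OF s alpha_transversal_has_derivatives[OF \<alpha> s]]
    by (simp add: algebra_simps)
  then have "k2 s * sinh (\<theta> s) - (vderiv \<alpha> s + k1 s) * cosh (\<theta> s) = 0"
    using \<eta> by (simp only: mult_eq_0_iff simp_thms)
  then show ?thesis
    by (simp add: lorentz_h_acceleration[OF s] algebra_simps)
qed

end

theorem theorem4p2:
  fixes I :: "real set"
    and c q h a :: "real \<Rightarrow> real^3"
    and k1 k2 \<theta> \<alpha> \<mu> \<eta> :: "real \<Rightarrow> real"
  assumes "timelike_ruled_surface_Nminus I c q h a k1 k2 \<theta>"
    and "alpha_transversal I q h \<alpha> \<mu> \<eta>"
    and "\<forall>s\<in>I. striction_curve c (transversal_ruling \<mu> \<eta> q h) s = c s"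
  shows "asymptotic_line I h c \<longleftrightarrow> \<alpha> constant_on I"
proof -
  interpret timelike_ruled_surface_Nminus I c q h a k1 k2 \<theta>
    by (rule assms(1))
  have "smooth_on \<alpha> I"
    using assms(2) by (simp add: alpha_transversal_def)
  then have "\<alpha> constant_on I \<longleftrightarrow> (\<forall>s\<in>I. vderiv \<alpha> s = 0)"
    by (rule constant_on_iff_vderiv_zero[OF interval(1,2)])
  \<comment> \<open>Since \<open>cosh (\<theta> s)\<close> is positive, both sides of the pointwise
    identity vanish together.\<close>
  moreover have "lorentz (h s) (vderiv (vderiv c) s) = 0 \<longleftrightarrow> vderiv \<alpha> s = 0" if "s \<in> I" for s
    using striction_coincides_imp[OF assms(2) that] assms(3) that cosh_real_pos[of "\<theta> s"]
    by (metis less_irrefl mult_eq_0_iff neg_equal_0_iff_equal)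
  ultimately show ?thesis
    by (simp add: asymptotic_line_def)
qed

end
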